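(* Let $n\ge 2$ and $0\le m\le \binom{n}{2}-1$. Then (i) $\mathbb{P}(\boldsymbol\sigma(n,m)\text{ is indecomposable})\le \mathbb{P}(\boldsymbol\sigma(n,m+1)\text{ is indecomposable})$; (ii) more generally, $C(\boldsymbol\sigma(n,m+1))$ is stochastically dominated by $C(\boldsymbol\sigma(n,m))$, i.e. \[ \mathbb{P}[C(\boldsymbol\sigma(n,m+1))\ge j]\le \mathbb{P}[C(\boldsymbol\sigma(n,m))\ge j]\quad\text{for all } j\in[n]. \]
   Context: $\boldsymbol\sigma(n,m)$ denotes a permutation chosen uniformly at random among all permutations of $[n]$ with exactly $m$ inversions (an inversion of $\boldsymbol\sigma=\sigma(1)\cdots\sigma(n)$ is a pair $i<j$ with $\sigma(i)>\sigma(j)$). A permutation $\boldsymbol\sigma$ of $[n]$ is decomposable if there is $k$ with $1\le k<n$ and $\{\sigma(1),\dots,\sigma(k)\}=\{1,\dots,k\}$, and indecomposable otherwise. Every permutation splits uniquely into indecomposable blocks: there are $0=k_0<k_1<\dots<k_l=n$ such that $\sigma(k_{i-1}+1)\cdots\sigma(k_i)$ is an indecomposable permutation of $\{k_{i-1}+1,\dots,k_i\}$ for each $i$ (indecomposability of a permutation of $\{a,\dots,b\}$ being defined analogously). $C(\boldsymbol\sigma)$ denotes the number $l$ of blocks. *)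

theory Defs
  imports "HOL-Probability.Probability"
begin

text \<open>
  A permutation of \<open>[n]\<close> is a function \<open>\<sigma> :: nat \<Rightarrow> nat\<close> with \<open>\<sigma> permutes {1..n}\<close>; it is
  the identity outside \<open>{1..n}\<close>, so distinct functions are distinct permutations of \<open>[n]\<close>.
\<close>

definition inversions :: "nat \<Rightarrow> (nat \<Rightarrow> nat) \<Rightarrow> (nat \<times> nat) set" where
  "inversions n \<sigma> = {(i, j). 1 \<le> i \<and> i < j \<and> j \<le> n \<and> \<sigma> i > \<sigma> j}"

definition perms_inv :: "nat \<Rightarrow> nat \<Rightarrow> (nat \<Rightarrow> nat) set" where
  "perms_inv n m = {\<sigma>. \<sigma> permutes {1..n} \<and> card (inversions n \<sigma>) = m}"

text \<open>Only meaningful for \<open>m \<le> n choose 2\<close>, where \<open>perms_inv n m\<close> is nonempty.\<close>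

definition random_perm :: "nat \<Rightarrow> nat \<Rightarrow> (nat \<Rightarrow> nat) pmf" where
  "random_perm n m = pmf_of_set (perms_inv n m)"

text \<open>
  The word \<open>\<sigma>(a) \<dots> \<sigma>(b)\<close> is a permutation of \<open>{a..b}\<close> iff \<open>\<sigma> ` {a..b} = {a..b}\<close>; the two
  predicates below refer to that word only and not to the values of \<open>\<sigma>\<close> elsewhere.
\<close>

definition decomposable_on :: "nat \<Rightarrow> nat \<Rightarrow> (nat \<Rightarrow> nat) \<Rightarrow> bool" where
  "decomposable_on a b \<sigma> \<longleftrightarrow>
     \<sigma> ` {a..b} = {a..b} \<and> (\<exists>k. a \<le> k \<and> k < b \<and> \<sigma> ` {a..k} = {a..k})"

definition indecomposable_on :: "nat \<Rightarrow> nat \<Rightarrow> (nat \<Rightarrow> nat) \<Rightarrow> bool" where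
  "indecomposable_on a b \<sigma> \<longleftrightarrow> \<sigma> ` {a..b} = {a..b} \<and> \<not> decomposable_on a b \<sigma>"

abbreviation indecomposable :: "nat \<Rightarrow> (nat \<Rightarrow> nat) \<Rightarrow> bool" where
  "indecomposable n \<sigma> \<equiv> indecomposable_on 1 n \<sigma>"

definition block_cuts :: "nat \<Rightarrow> (nat \<Rightarrow> nat) \<Rightarrow> nat \<Rightarrow> (nat \<Rightarrow> nat) \<Rightarrow> bool" where
  "block_cuts n \<sigma> l k \<longleftrightarrow>
     k 0 = 0 \<and> k l = n \<and> (\<forall>i\<in>{1..l}. k (i - 1) < k i) \<and>
     (\<forall>i\<in>{1..l}. indecomposable_on (k (i - 1) + 1) (k i) \<sigma>)"

text \<open>Well defined by \<open>ex1_block_cuts\<close> below.\<close>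

definition num_blocks :: "nat \<Rightarrow> (nat \<Rightarrow> nat) \<Rightarrow> nat" where
  "num_blocks n \<sigma> = (THE l. \<exists>k. block_cuts n \<sigma> l k)"

lemma image_Icc_append:
  fixes \<sigma> :: "nat \<Rightarrow> nat"
  assumes "\<sigma> ` {1..c} = {1..c}" "\<sigma> ` {c+1..d} = {c+1..d}" "c \<le> d"
  shows "\<sigma> ` {1..d} = {1..d}"
proof -
  have "{1..d} = {1..c} \<union> {c+1..d}" using assms(3) by auto
  then show ?thesis using assms by (simp add: image_Un)
qed

lemma image_Icc_diff:
  fixes \<sigma> :: "nat \<Rightarrow> nat"
  assumes "inj \<sigma>" "\<sigma> ` {1..c} = {1..c}" "\<sigma> ` {1..d} = {1..d}"
  shows "\<sigma> ` {c+1..d} = {c+1..d}"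
proof -
  have "{c+1..d} = {1..d} - {1..c}" by auto
  then show ?thesis using assms by (simp add: image_set_diff)
qed

lemma ex_block_cuts:
  assumes "inj \<sigma>" "\<sigma> ` {1..n} = {1..n}"
  shows "\<exists>l k. block_cuts n \<sigma> l k"
  using assms(2)
proof (induction n rule: less_induct)
  case (less n)
  show ?case
  proof (cases "n = 0")
    case True
    then have "block_cuts n \<sigma> 0 (\<lambda>_. 0)" by (simp add: block_cuts_def)
    then show ?thesis by blast
  next
    case False
    let ?P = "\<lambda>c. c < n \<and> \<sigma> ` {1..c} = {1..c}"
    have P0: "?P 0" using False by simp
    have bd: "\<And>y. ?P y \<Longrightarrow> y \<le> n" by auto
    obtain c where c: "?P c" and cmax: "\<And>y. ?P y \<Longrightarrow> y \<le> c"
      using GreatestI_nat[of ?P, OF P0 bd] Greatest_le_nat[of ?P _ n, OF _ bd] by blast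
    obtain l k where lk: "block_cuts c \<sigma> l k" using less.IH[of c] c by auto
    have img: "\<sigma> ` {c+1..n} = {c+1..n}"
      using image_Icc_diff[OF assms(1)] c less.prems by blast
    have ind: "indecomposable_on (c+1) n \<sigma>"
      unfolding indecomposable_on_def decomposable_on_def
      using img image_Icc_append[of \<sigma> c] c cmax
      by (metis Suc_eq_plus1 Suc_leD not_less_eq_eq)
    have "block_cuts n \<sigma> (Suc l) (k(Suc l := n))"
      using lk ind c unfolding block_cuts_def by (auto simp: le_Suc_eq)
    then show ?thesis by blast
  qed
qed

lemma block_cuts_mono:
  assumes "block_cuts n \<sigma> l k" "i \<le> j" "j \<le> l"
  shows "k i \<le> k j" and "i < j \<Longrightarrow> k i < k j"
proof -
  have *: "k i < k j" if "i < j" "j \<le> l" for i j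
    using that
  proof (induction j)
    case (Suc j)
    have "k j < k (Suc j)" using assms(1) Suc.prems unfolding block_cuts_def
      by (metis Suc_le_eq atLeastAtMost_iff diff_Suc_1 le_add1 plus_1_eq_Suc)
    then show ?case using Suc by (cases "i = j") auto
  qed simp
  show "k i \<le> k j" using * assms(2,3) by (cases "i = j") (auto intro: less_imp_le)
  show "i < j \<Longrightarrow> k i < k j" using * assms(3) by blast
qed

lemma block_cuts_image:
  assumes "inj \<sigma>" "block_cuts n \<sigma> l k"
  shows "k ` {..l} = {c. c \<le> n \<and> \<sigma> ` {1..c} = {1..c}}"
proof -
  have k0: "k 0 = 0" and kl: "k l = n"
    and mono: "\<And>i. Suc i \<le> l \<Longrightarrow> k i < k (Suc i)"
    and ind: "\<And>i. Suc i \<le> l \<Longrightarrow> indecomposable_on (k i + 1) (k (Suc i)) \<sigma>"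
    using assms(2) unfolding block_cuts_def by force+
  have cut: "\<sigma> ` {1..k i} = {1..k i}" if "i \<le> l" for i
    using that
  proof (induction i)
    case 0
    then show ?case by (simp add: k0)
  next
    case (Suc i)
    have "\<sigma> ` {k i + 1..k (Suc i)} = {k i + 1..k (Suc i)}"
      using ind[OF Suc.prems] unfolding indecomposable_on_def by blast
    then show ?case
      using image_Icc_append[of \<sigma> "k i" "k (Suc i)"] Suc mono[OF Suc.prems] by simp
  qed
  have "c \<in> k ` {..l}" if c: "c \<le> n" "\<sigma> ` {1..c} = {1..c}" for c
  proof (rule ccontr)
    assume nin: "c \<notin> k ` {..l}"
    have "\<forall>i\<le>l. k i < c"
    proof (intro allI impI)
      fix i assume "i \<le> l"
      then show "k i < c"
      proof (induction i)
        case 0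
        have "c \<noteq> k 0" using nin by blast
        then show ?case by (simp add: k0)
      next
        case (Suc i)
        have lt: "k i < c" using Suc by simp
        show ?case
        proof (rule ccontr)
          assume "\<not> k (Suc i) < c"
          moreover have "c \<noteq> k (Suc i)" using nin Suc.prems by blast
          ultimately have "c < k (Suc i)" by simp
          moreover have "\<sigma> ` {k i + 1..c} = {k i + 1..c}"
            using image_Icc_diff[OF assms(1) cut c(2)] Suc.prems by simp
          ultimately have "decomposable_on (k i + 1) (k (Suc i)) \<sigma>"
            using ind[OF Suc.prems] lt
            unfolding indecomposable_on_def decomposable_on_def by auto
          then show False using ind[OF Suc.prems] by (simp add: indecomposable_on_def)
        qed
      qed
    qed
    then show False using kl c(1) by auto
  qed
  moreover have "k i \<le> n" if "i \<le> l" for i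
    using block_cuts_mono(1)[OF assms(2) that] kl by simp
  ultimately show ?thesis using cut by blast
qed

lemma ex1_block_cuts:
  assumes "\<sigma> permutes {1..n}"
  shows "\<exists>!l. \<exists>k. block_cuts n \<sigma> l k"
proof -
  have inj: "inj \<sigma>" using assms by (rule permutes_inj)
  have "\<exists>l k. block_cuts n \<sigma> l k"
    using ex_block_cuts[OF inj permutes_image[OF assms]] .
  moreover have "Suc l = card {c. c \<le> n \<and> \<sigma> ` {1..c} = {1..c}}"
    if "block_cuts n \<sigma> l k" for l k
  proof -
    have "inj_on k {..l}"
      using block_cuts_mono(2)[OF that]
      by (intro linorder_inj_onI) (auto simp: less_imp_neq)
    then have "card (k ` {..l}) = Suc l" by (simp add: card_image)
    then show ?thesis using block_cuts_image[OF inj that] by simp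
  qed
  ultimately show ?thesis by (metis nat.inject)
qed

end

theory Submission
  imports Defs
begin

text \<open>
  A permutation is encoded by its inversion sequence, whose \<open>i\<close>-th entry ranges freely over
  \<open>{0..i - 1}\<close> and whose sum is the number of inversions. The position \<open>c\<close> separates two blocks
  iff the entries after \<open>c\<close> are small enough to form an inversion sequence on their own, so raising
  entries can only destroy block boundaries. It therefore suffices that the mean of a coordinatewise
  increasing function over the inversion sequences with a given sum increases with that sum. This is
  Efron's theorem for independent uniform (hence log-concave) variables; it follows by induction on
  the number of coordinates.
\<close>

section \<open>Log-concave sequences\<close>

text \<open>The four-point form is total positivity of order two of the kernel
  \<open>a (i - j)\<close>. Unlike the condition on three neighbouring values, it also excludes
  internal zeros.\<close>

definition log_concave :: "(int \<Rightarrow> real) \<Rightarrow> bool" where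
  "log_concave a \<longleftrightarrow> (\<forall>s. 0 \<le> a s) \<and>
     (\<forall>i j d. i \<le> j \<longrightarrow> 0 \<le> d \<longrightarrow> a i * a (j + d) \<le> a (i + d) * a j)"

lemma log_concave_nonneg: "log_concave a \<Longrightarrow> 0 \<le> a s"
  by (simp add: log_concave_def)

lemma log_concaveD:
  "log_concave a \<Longrightarrow> i \<le> j \<Longrightarrow> 0 \<le> d \<Longrightarrow> a i * a (j + d) \<le> a (i + d) * a j"
  by (simp add: log_concave_def)

lemma log_concave_indicator_Icc: "log_concave (\<lambda>s. of_bool (l \<le> s \<and> s \<le> u))"
  by (auto simp: log_concave_def)

text \<open>Cauchy-Binet for two-by-two determinants: antisymmetrising in \<open>t\<close> and
  \<open>t'\<close> counts each unordered pair twice, hence the factor 2.\<close>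

lemma cauchy_binet_2:
  fixes p q x y :: "'a \<Rightarrow> real"
  shows "2 * ((\<Sum>t\<in>U. p t * x t) * (\<Sum>t\<in>U. q t * y t) - (\<Sum>t\<in>U. p t * y t) * (\<Sum>t\<in>U. q t * x t))
    = (\<Sum>t\<in>U. \<Sum>t'\<in>U. (p t * q t' - p t' * q t) * (x t * y t' - x t' * y t))"
proof -
  let ?D = "\<lambda>t t'. p t * x t * (q t' * y t') - p t * y t * (q t' * x t')"
  have D: "(\<Sum>t\<in>U. p t * x t) * (\<Sum>t\<in>U. q t * y t) - (\<Sum>t\<in>U. p t * y t) * (\<Sum>t\<in>U. q t * x t)
      = (\<Sum>t\<in>U. \<Sum>t'\<in>U. ?D t t')"
    by (simp add: sum_product sum_subtractf)
  have "(\<Sum>t\<in>U. \<Sum>t'\<in>U. ?D t t') = (\<Sum>t\<in>U. \<Sum>t'\<in>U. ?D t' t)"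
    by (rule sum.swap)
  then have "2 * (\<Sum>t\<in>U. \<Sum>t'\<in>U. ?D t t') = (\<Sum>t\<in>U. \<Sum>t'\<in>U. ?D t t' + ?D t' t)"
    by (simp only: sum.distrib)
  also have "\<dots> = (\<Sum>t\<in>U. \<Sum>t'\<in>U. (p t * q t' - p t' * q t) * (x t * y t' - x t' * y t))"
    by (intro sum.cong refl) (simp add: algebra_simps)
  finally show ?thesis by (simp only: D)
qed

text \<open>By Cauchy-Binet the defect is a sum of products of a minor of \<open>a\<close> and a
  minor of \<open>b\<close>, of opposite signs for \<open>t\<close> below \<open>t'\<close>.
  Exchanging \<open>t\<close> and \<open>t'\<close> negates both minors, so every product has the
  same sign.\<close>

lemma log_concave_convolution:
  assumes a: "log_concave a" and b: "log_concave b"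
    and supp: "\<And>t. b t \<noteq> 0 \<Longrightarrow> l \<le> t \<and> t \<le> u"
  shows "log_concave (\<lambda>s. \<Sum>t\<in>{l..u}. a (s - t) * b t)"
  unfolding log_concave_def
proof (intro conjI allI impI)
  show "0 \<le> (\<Sum>t\<in>{l..u}. a (s - t) * b t)" for s
    by (intro sum_nonneg mult_nonneg_nonneg log_concave_nonneg a b)
next
  fix i j d :: int assume ij: "i \<le> j" and d: "0 \<le> d"
  \<comment> \<open>A common range for the supports of \<open>b\<close> and of its shift by
    \<open>d\<close>.\<close>
  define U where "U = {l - d..u}"
  have N: "(\<Sum>t\<in>{l..u}. a (s - t) * b t) = (\<Sum>t\<in>U. a (s - t) * b t)" for s
    by (rule sum.mono_neutral_left) (use supp d in \<open>auto simp: U_def\<close>)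
  have Nd: "(\<Sum>t\<in>{l..u}. a (s + d - t) * b t) = (\<Sum>t\<in>U. a (s - t) * b (t + d))" for s
  proof -
    have "(\<Sum>t\<in>{l..u}. a (s + d - t) * b t) = (\<Sum>t\<in>{l - d..u - d}. a (s - t) * b (t + d))"
      by (rule sum.reindex_bij_witness[where i="\<lambda>t. t + d" and j="\<lambda>t. t - d"]) (auto simp: algebra_simps)
    also have "\<dots> = (\<Sum>t\<in>U. a (s - t) * b (t + d))"
      by (rule sum.mono_neutral_left) (use supp d in \<open>force simp: U_def\<close>)+
    finally show ?thesis .
  qed
  have A: "a (i - t') * a (j - t) \<le> a (i - t) * a (j - t')" if "t \<le> t'" for t t'
    using log_concaveD[OF a, of "i - t'" "j - t'" "t' - t"] ij that by simp
  have B: "b t * b (t' + d) \<le> b (t + d) * b t'" if "t \<le> t'" for t t'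
    using log_concaveD[OF b that d] by (simp add: mult.commute)
  have "(\<Sum>t\<in>U. \<Sum>t'\<in>U. (a (i - t) * a (j - t') - a (i - t') * a (j - t))
      * (b t * b (t' + d) - b t' * b (t + d))) \<le> 0"
  proof (intro sum_nonpos)
    fix t t'
    show "(a (i - t) * a (j - t') - a (i - t') * a (j - t))
      * (b t * b (t' + d) - b t' * b (t + d)) \<le> 0"
    proof (cases "t \<le> t'")
      case True
      show ?thesis
        using A[OF True] B[OF True] by (intro mult_nonneg_nonpos) (simp_all add: mult.commute)
    next
      case False
      then have "t' \<le> t" by simp
      from A[OF this] B[OF this] show ?thesis
        by (intro mult_nonpos_nonneg) (simp_all add: mult.commute)
    qed
  qed
  then have "(\<Sum>t\<in>U. a (i - t) * b t) * (\<Sum>t\<in>U. a (j - t) * b (t + d))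
      \<le> (\<Sum>t\<in>U. a (i - t) * b (t + d)) * (\<Sum>t\<in>U. a (j - t) * b t)"
    unfolding cauchy_binet_2[symmetric] by simp
  then show "(\<Sum>t\<in>{l..u}. a (i - t) * b t) * (\<Sum>t\<in>{l..u}. a (j + d - t) * b t)
      \<le> (\<Sum>t\<in>{l..u}. a (i + d - t) * b t) * (\<Sum>t\<in>{l..u}. a (j - t) * b t)"
    unfolding Nd unfolding N .
qed

text \<open>A convolution with the uniform weights on \<open>{0..c}\<close>, which is the effect of
  appending one free entry.\<close>

lemma log_concave_window_sum:
  assumes "log_concave a"
  shows "log_concave (\<lambda>s. \<Sum>k\<le>c. a (s - int k))"
proof -
  have "log_concave (\<lambda>s. \<Sum>t\<in>{0..int c}. a (s - t) * of_bool (0 \<le> t \<and> t \<le> int c))"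
    by (rule log_concave_convolution[OF assms log_concave_indicator_Icc]) auto
  moreover have "(\<Sum>t\<in>{0..int c}. a (s - t) * of_bool (0 \<le> t \<and> t \<le> int c)) = (\<Sum>k\<le>c. a (s - int k))" for s
    by (rule sum.reindex_bij_witness[where i=int and j=nat]) auto
  ultimately show ?thesis by simp
qed

section \<open>Transport between two adjacent windows\<close>

text \<open>
  The mass \<open>b (k + 1)\<close> at the point \<open>k\<close> of the lower window is moved to the points \<open>k\<close> and
  \<open>k + 1\<close> of the upper window in the amounts \<open>v k\<close> and \<open>u k\<close>, after both windows have been
  scaled to the same total mass. Log-concavity makes \<open>u\<close> nonnegative.
\<close>

lemma window_transport:
  fixes b G H :: "nat \<Rightarrow> real"
  assumes b: "\<And>k. 0 \<le> b k"
    and lc: "\<And>p q. p < q \<Longrightarrow> b p * b (Suc q) \<le> b (Suc p) * b q"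
    and GH: "\<And>k. k \<le> c \<Longrightarrow> 0 < b k \<Longrightarrow> 0 < b (Suc k) \<Longrightarrow> H k \<le> G k"
    and GH': "\<And>k. k < c \<Longrightarrow> H k \<le> G (Suc k)"
  shows "(\<Sum>k\<le>c. b (Suc k) * H k) * (\<Sum>k\<le>c. b k) \<le> (\<Sum>k\<le>c. b k * G k) * (\<Sum>k\<le>c. b (Suc k))"
proof -
  define N where "N = (\<Sum>k\<le>c. b (Suc k))"
  define N' where "N' = (\<Sum>k\<le>c. b k)"
  \<comment> \<open>Scaled by each other's total, both windows have mass \<open>N * N'\<close>. The
    excess of the lower one on the points up to \<open>k\<close> must cross to \<open>k + 1\<close>;
    this is \<open>u k\<close>, and \<open>v k\<close> is what stays.\<close>
  define u where "u k = N' * (\<Sum>i\<le>k. b (Suc i)) - N * (\<Sum>i\<le>k. b i)" for k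
  define v where "v k = N * (\<Sum>i\<le>k. b i) - N' * (\<Sum>i<k. b (Suc i))" for k
  have uv: "u k + v k = b (Suc k) * N'" for k
  proof -
    have "(\<Sum>i\<le>k. b (Suc i)) = (\<Sum>i<k. b (Suc i)) + b (Suc k)"
      by (simp add: lessThan_Suc_atMost[symmetric])
    then show ?thesis by (simp add: u_def v_def algebra_simps)
  qed
  have v0: "v 0 = b 0 * N" by (simp add: v_def)
  have uvS: "u k + v (Suc k) = b (Suc k) * N" for k
    by (simp add: u_def v_def algebra_simps lessThan_Suc_atMost)
  \<comment> \<open>The scaled totals agree, so nothing leaves the window at its upper end.\<close>
  have uc: "u c = 0" by (simp add: u_def N_def N'_def)
  have split: "(\<Sum>i\<le>c. f i) = (\<Sum>i\<le>k. f i) + (\<Sum>i\<in>{k<..c}. f i)" if "k \<le> c" for k and f :: "nat \<Rightarrow> real"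
  proof -
    have "{..c} = {..k} \<union> {k<..c}" using that by auto
    then show ?thesis by (simp only:) (rule sum.union_disjoint, auto)
  qed
  have u: "0 \<le> u k" if "k \<le> c" for k
  proof -
    have "u k = (\<Sum>i\<le>k. b (Suc i)) * (\<Sum>j\<in>{k<..c}. b j) - (\<Sum>i\<le>k. b i) * (\<Sum>j\<in>{k<..c}. b (Suc j))"
      unfolding u_def N_def N'_def split[OF that] by (simp add: algebra_simps)
    also have "\<dots> = (\<Sum>i\<le>k. \<Sum>j\<in>{k<..c}. b (Suc i) * b j - b i * b (Suc j))"
      by (simp add: sum_product sum_subtractf)
    also have "\<dots> \<ge> 0" by (intro sum_nonneg) (simp add: lc)
    finally show ?thesis .
  qed
  \<comment> \<open>The two windows differ only in the end weights \<open>b 0\<close> and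
    \<open>b (Suc c)\<close>, so the mixed terms cancel and products of nonnegative weights
    remain.\<close>
  have v: "0 \<le> v k" if "k \<le> c" for k
  proof -
    define Z where "Z = (\<Sum>i<k. b (Suc i))"
    define T where "T = (\<Sum>i\<in>{k<..c}. b i)"
    have Z0: "0 \<le> Z" "0 \<le> T" by (auto simp: Z_def T_def intro: sum_nonneg b)
    have X: "(\<Sum>i\<le>k. b i) = b 0 + Z" by (simp add: Z_def sum.atMost_shift)
    have N': "N' = b 0 + Z + T" by (simp add: N'_def split[OF that] X T_def)
    have "b 0 + N = (\<Sum>k\<le>Suc c. b k)" unfolding N_def by (simp add: sum.atMost_Suc_shift del: sum.atMost_Suc)
    then have N: "N = Z + T + b (Suc c)" using N' by (simp add: N'_def)
    have "v k = b 0 * T + b (Suc c) * b 0 + b (Suc c) * Z"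
      unfolding v_def X N N' Z_def[symmetric] by (simp add: algebra_simps)
    then show ?thesis using Z0 b by simp
  qed
  \<comment> \<open>\<open>GH\<close> compares \<open>H k\<close> with \<open>G k\<close> only where
    both weights are positive. If one vanishes, there is nothing to move or no room to receive it,
    so no mass stays at \<open>k\<close>.\<close>
  have v_zero: "v k = 0" if "k \<le> c" "b k = 0 \<or> b (Suc k) = 0" for k
  proof (cases "b (Suc k) = 0")
    case True
    then show ?thesis using uv[of k] u[OF that(1)] v[OF that(1)] by simp
  next
    case False
    with that have bk: "b k = 0" by simp
    show ?thesis
    proof (cases k)
      case 0
      then show ?thesis using bk v0 by simp
    next
      case (Suc i)
      then show ?thesis using uvS[of i] u[of i] v[OF that(1)] bk that(1) by simp
    qed
  qed
  have pos_or_zero: "0 < b k \<or> b k = 0" for k using b[of k] by linarith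
  \<comment> \<open>The mass at each upper point is regrouped by the lower point it came
    from.\<close>
  have "(\<Sum>k\<le>c. b k * G k) * N = v 0 * G 0 + (\<Sum>k<c. (u k + v (Suc k)) * G (Suc k))"
    by (simp add: sum.atMost_shift uvS v0 sum_distrib_right sum_distrib_left algebra_simps)
  also have "\<dots> = (\<Sum>k\<le>c. v k * G k) + (\<Sum>k<c. u k * G (Suc k))"
    by (simp add: sum.atMost_shift algebra_simps sum.distrib)
  finally have top: "(\<Sum>k\<le>c. b k * G k) * N = (\<Sum>k\<le>c. v k * G k) + (\<Sum>k<c. u k * G (Suc k))" .
  have "(\<Sum>k\<le>c. b (Suc k) * H k) * N' = (\<Sum>k\<le>c. (u k + v k) * H k)"
    by (simp add: uv sum_distrib_right sum_distrib_left algebra_simps)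
  also have "\<dots> = (\<Sum>k\<le>c. v k * H k) + (\<Sum>k\<le>c. u k * H k)"
    by (simp add: algebra_simps sum.distrib)
  also have "(\<Sum>k\<le>c. u k * H k) = (\<Sum>k<c. u k * H k)"
    by (simp add: lessThan_Suc_atMost[symmetric] uc)
  finally have bot: "(\<Sum>k\<le>c. b (Suc k) * H k) * N' = (\<Sum>k\<le>c. v k * H k) + (\<Sum>k<c. u k * H k)" .
  have "(\<Sum>k\<le>c. v k * H k) \<le> (\<Sum>k\<le>c. v k * G k)"
  proof (rule sum_mono)
    fix k assume "k \<in> {..c}"
    then have k: "k \<le> c" by simp
    show "v k * H k \<le> v k * G k"
    proof (cases "b k = 0 \<or> b (Suc k) = 0")
      case True
      then show ?thesis using v_zero[OF k] by simp
    next
      case False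
      then show ?thesis
        using GH[OF k] pos_or_zero v[OF k] by (blast intro: mult_left_mono)
    qed
  qed
  moreover have "(\<Sum>k<c. u k * H k) \<le> (\<Sum>k<c. u k * G (Suc k))"
    by (intro sum_mono mult_left_mono GH' u) auto
  ultimately show ?thesis
    unfolding N_def[symmetric] N'_def[symmetric] top bot by linarith
qed

section \<open>Inversion sequences\<close>

definition inv_seqs :: "nat \<Rightarrow> nat list set" where
  "inv_seqs n = {xs. length xs = n \<and> (\<forall>i<n. xs ! i \<le> i)}"

text \<open>The level is an integer, so that negative levels are empty.\<close>

definition inv_seqs_sum :: "nat \<Rightarrow> int \<Rightarrow> nat list set" where
  "inv_seqs_sum n s = {xs \<in> inv_seqs n. int (sum_list xs) = s}"

lemma inv_seqs_0: "inv_seqs 0 = {[]}"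
  by (auto simp: inv_seqs_def)

lemma snoc_in_inv_seqs_iff: "xs @ [k] \<in> inv_seqs (Suc n) \<longleftrightarrow> xs \<in> inv_seqs n \<and> k \<le> n"
  by (auto simp: inv_seqs_def nth_append less_Suc_eq)

lemma inv_seqs_Suc_cases:
  assumes "ys \<in> inv_seqs (Suc n)"
  obtains xs k where "ys = xs @ [k]" "xs \<in> inv_seqs n" "k \<le> n"
proof -
  have "ys \<noteq> []" using assms by (auto simp: inv_seqs_def)
  then obtain xs k where "ys = xs @ [k]" by (metis rev_exhaust)
  then show thesis using assms that by (simp add: snoc_in_inv_seqs_iff)
qed

lemma bij_betw_inv_seqs_Suc:
  "bij_betw (\<lambda>(xs, k). xs @ [k]) (inv_seqs n \<times> {..n}) (inv_seqs (Suc n))"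
  by (auto simp: bij_betw_def inj_on_def snoc_in_inv_seqs_iff elim!: inv_seqs_Suc_cases)

text \<open>Used twice: a nonzero cardinality gives finiteness, and agreement with the number of
  permutations later gives surjectivity of \<open>inv_seq n\<close>.\<close>

lemma card_inv_seqs: "card (inv_seqs n) = fact n"
proof (induction n)
  case (Suc n)
  show ?case
    using bij_betw_same_card[OF bij_betw_inv_seqs_Suc, of n] Suc
    by (simp add: card_cartesian_product algebra_simps)
qed (simp add: inv_seqs_0)

lemma finite_inv_seqs: "finite (inv_seqs n)"
  using card_inv_seqs[of n] by (metis card.infinite fact_nonzero)

lemma finite_inv_seqs_sum: "finite (inv_seqs_sum n s)"
  unfolding inv_seqs_sum_def using finite_inv_seqs by simp

lemma sum_inv_seqs_sum_Suc:
  "(\<Sum>xs\<in>inv_seqs_sum (Suc n) s. f xs)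
    = (\<Sum>k\<le>n. \<Sum>xs\<in>inv_seqs_sum n (s - int k). f (xs @ [k]) :: real)"
proof -
  have "(\<Sum>k\<le>n. \<Sum>xs\<in>inv_seqs_sum n (s - int k). f (xs @ [k]))
      = (\<Sum>(k, xs)\<in>Sigma {..n} (\<lambda>k. inv_seqs_sum n (s - int k)). f (xs @ [k]))"
    by (rule sum.Sigma) (auto simp: finite_inv_seqs_sum)
  also have "\<dots> = (\<Sum>xs\<in>inv_seqs_sum (Suc n) s. f xs)"
    by (rule sum.reindex_bij_witness[where i="\<lambda>ys. (last ys, butlast ys)" and j="\<lambda>(k, xs). xs @ [k]"])
       (auto simp: inv_seqs_sum_def snoc_in_inv_seqs_iff elim!: inv_seqs_Suc_cases)
  finally show ?thesis by simp
qed

lemma card_inv_seqs_sum_Suc: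
  "real (card (inv_seqs_sum (Suc n) s)) = (\<Sum>k\<le>n. real (card (inv_seqs_sum n (s - int k))))"
  using sum_inv_seqs_sum_Suc[of "\<lambda>_. 1"] by simp

lemma inv_seqs_sum_0: "inv_seqs_sum 0 s = (if s = 0 then {[]} else {})"
  by (auto simp: inv_seqs_sum_def inv_seqs_0)

lemma log_concave_card_inv_seqs_sum: "log_concave (\<lambda>s. real (card (inv_seqs_sum n s)))"
proof (induction n)
  case 0
  have "(0 \<le> s \<and> s \<le> 0) = (s = 0)" for s :: int by auto
  then show ?case using log_concave_indicator_Icc[of 0 0] by (simp add: inv_seqs_sum_0 if_distrib of_bool_def cong: if_cong)
next
  case (Suc n)
  show ?case unfolding card_inv_seqs_sum_Suc by (rule log_concave_window_sum[OF Suc])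
qed

lemma inv_seqs_sum_nonempty: "m \<le> n choose 2 \<Longrightarrow> inv_seqs_sum n (int m) \<noteq> {}"
proof (induction n arbitrary: m)
  case 0
  then show ?case by (simp add: inv_seqs_sum_0 numeral_2_eq_2)
next
  case (Suc n)
  \<comment> \<open>Greedy choice: the last entry takes as much of the sum as it can.\<close>
  let ?k = "min n m"
  have "Suc n choose 2 = n + (n choose 2)" by (simp add: numeral_2_eq_2)
  then have "m - ?k \<le> n choose 2" using Suc.prems by linarith
  then obtain xs where "xs \<in> inv_seqs_sum n (int (m - ?k))" using Suc.IH by blast
  then have "xs @ [?k] \<in> inv_seqs_sum (Suc n) (int m)"
    by (auto simp: inv_seqs_sum_def snoc_in_inv_seqs_iff)
  then show ?case by blast
qed

text \<open>
  Efron's monotonicity theorem for independent uniform coordinates conditioned on their sum, with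
  the denominators cleared. Conditioning on the last coordinate reduces it to two summands, where
  the transport lemma applies.
\<close>

theorem inv_seqs_sum_mean_mono:
  fixes f :: "nat list \<Rightarrow> real"
  assumes "\<And>xs ys. list_all2 (\<le>) xs ys \<Longrightarrow> f xs \<le> f ys"
  shows "(\<Sum>xs\<in>inv_seqs_sum n s. f xs) * card (inv_seqs_sum n (s + 1))
       \<le> (\<Sum>xs\<in>inv_seqs_sum n (s + 1). f xs) * card (inv_seqs_sum n s)"
  using assms
proof (induction n arbitrary: f s)
  case 0
  show ?case by (simp add: inv_seqs_sum_0)
next
  case (Suc n)
  define a where "a t = real (card (inv_seqs_sum n t))" for t
  define F where "F t k = (\<Sum>xs\<in>inv_seqs_sum n t. f (xs @ [k]))" for t k
  define b where "b k = a (s + 1 - int k)" for k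
  \<comment> \<open>Conditional means given the last entry \<open>k\<close>. On an empty level the
    weight and \<open>F\<close> both vanish, so \<open>bG\<close> and \<open>bH\<close> hold for
    every \<open>k\<close>. Lowering the level by one amounts to raising \<open>k\<close> by one,
    hence the weight \<open>b (Suc k)\<close> of \<open>H k\<close>.\<close>
  define G where "G k = F (s + 1 - int k) k / a (s + 1 - int k)" for k
  define H where "H k = F (s - int k) k / a (s - int k)" for k
  have bS: "b (Suc k) = a (s - int k)" for k by (simp add: b_def)
  have lc: "log_concave a" unfolding a_def by (rule log_concave_card_inv_seqs_sum)
  have F0: "F t k = 0" if "a t = 0" for t k
    using that by (auto simp: a_def F_def finite_inv_seqs_sum)
  have bG: "b k * G k = F (s + 1 - int k) k" for k
    using F0 by (auto simp: b_def G_def)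
  have bH: "b (Suc k) * H k = F (s - int k) k" for k
    using F0 by (auto simp: bS H_def)
  have "(\<Sum>k\<le>n. b (Suc k) * H k) * (\<Sum>k\<le>n. b k) \<le> (\<Sum>k\<le>n. b k * G k) * (\<Sum>k\<le>n. b (Suc k))"
  proof (rule window_transport)
    show "0 \<le> b k" for k unfolding b_def by (rule log_concave_nonneg[OF lc])
    show "b p * b (Suc q) \<le> b (Suc p) * b q" if "p < q" for p q
      using log_concaveD[OF lc, of "s - int q" "s - int p" 1] that
      by (simp add: bS b_def mult.commute add.commute add_diff_eq)
    \<comment> \<open>Same last entry, prefix sums one apart: the induction hypothesis.\<close>
    show "H k \<le> G k" if "0 < b k" "0 < b (Suc k)" for k
    proof -
      have "F (s - int k) k * a (s - int k + 1) \<le> F (s - int k + 1) k * a (s - int k)"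
        unfolding F_def a_def
        by (rule Suc.IH) (auto intro!: Suc.prems list_all2_appendI)
      moreover have "s - int k + 1 = s + 1 - int k" by simp
      ultimately show ?thesis
        using that unfolding G_def H_def bS b_def by (simp add: divide_simps mult.commute)
    qed
    \<comment> \<open>Same prefix level, last entry raised by one: monotonicity of
      \<open>f\<close>.\<close>
    show "H k \<le> G (Suc k)" for k
    proof -
      have "F (s - int k) k \<le> F (s - int k) (Suc k)"
        unfolding F_def
        by (intro sum_mono Suc.prems list_all2_appendI list_all2_refl) auto
      then show ?thesis
        using log_concave_nonneg[OF lc] unfolding G_def H_def by (simp add: divide_right_mono)
    qed
  qed
  then show ?case
    unfolding sum_inv_seqs_sum_Suc card_inv_seqs_sum_Suc
    unfolding bG bH unfolding bS unfolding b_def F_def a_def .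
qed

section \<open>The inversion sequence of a permutation\<close>

definition inv_count :: "(nat \<Rightarrow> nat) \<Rightarrow> nat \<Rightarrow> nat" where
  "inv_count \<sigma> i = card {j. 1 \<le> j \<and> j < i \<and> \<sigma> i < \<sigma> j}"

text \<open>The entry at list position \<open>i\<close> belongs to the letter at position \<open>i + 1\<close> of the permutation.\<close>

definition inv_seq :: "nat \<Rightarrow> (nat \<Rightarrow> nat) \<Rightarrow> nat list" where
  "inv_seq n \<sigma> = map (\<lambda>i. inv_count \<sigma> (Suc i)) [0..<n]"

lemma inv_count_le: "inv_count \<sigma> (Suc i) \<le> i"
proof -
  have "inv_count \<sigma> (Suc i) \<le> card {1..i}"
    unfolding inv_count_def by (rule card_mono) auto
  then show ?thesis by simp
qed

lemma inv_seq_in_inv_seqs: "inv_seq n \<sigma> \<in> inv_seqs n"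
  by (simp add: inv_seqs_def inv_seq_def inv_count_le)

lemma sum_list_inv_seq: "sum_list (inv_seq n \<sigma>) = card (inversions n \<sigma>)"
proof -
  have "inversions n \<sigma> = (\<lambda>(j, i). (i, j)) ` Sigma {1..n} (\<lambda>j. {i. 1 \<le> i \<and> i < j \<and> \<sigma> j < \<sigma> i})"
    by (auto simp: inversions_def image_iff)
  then have "card (inversions n \<sigma>) = card (Sigma {1..n} (\<lambda>j. {i. 1 \<le> i \<and> i < j \<and> \<sigma> j < \<sigma> i}))"
    by (simp add: card_image inj_on_def)
  also have "\<dots> = (\<Sum>j\<in>{1..n}. inv_count \<sigma> j)"
    unfolding inv_count_def by (rule card_SigmaI) auto
  also have "\<dots> = (\<Sum>i<n. inv_count \<sigma> (Suc i))"
    by (rule sum.reindex_bij_witness[where i=Suc and j="\<lambda>j. j - 1"]) auto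
  also have "\<dots> = sum_list (inv_seq n \<sigma>)"
    by (simp add: inv_seq_def interv_sum_list_conv_sum_set_nat atLeast0LessThan)
  finally show ?thesis by simp
qed

text \<open>An element of a finite set is determined by its rank from the top: of two distinct
  elements, only the smaller has the larger one above it.\<close>

lemma card_greater_inj:
  fixes A :: "nat set"
  assumes "finite A" "x \<in> A" "y \<in> A" "card {z \<in> A. x < z} = card {z \<in> A. y < z}"
  shows "x = y"
proof -
  have *: "card {z \<in> A. y < z} < card {z \<in> A. x < z}" if "x < y" "y \<in> A" for x y
    by (rule psubset_card_mono) (use that assms(1) in auto)
  show ?thesis using *[of x y] *[of y x] assms by (cases x y rule: linorder_cases) auto
qed

text \<open>
  The letters are recovered from right to left: the inversion count gives the rank of a letter among
  the values not used further right.
\<close>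

lemma inj_on_inv_seq: "inj_on (inv_seq n) {\<sigma>. \<sigma> permutes {1..n}}"
proof (rule inj_onI, unfold mem_Collect_eq)
  fix \<sigma> \<tau> assume s: "\<sigma> permutes {1..n}" and t: "\<tau> permutes {1..n}"
    and eq: "inv_seq n \<sigma> = inv_seq n \<tau>"
  have cnt: "inv_count \<sigma> i = inv_count \<tau> i" if "i \<in> {1..n}" for i
  proof -
    have "inv_seq n \<sigma> ! (i - 1) = inv_seq n \<tau> ! (i - 1)" using eq by simp
    then show ?thesis using that by (cases i) (simp_all add: inv_seq_def del: upt_Suc)
  qed
  \<comment> \<open>The count depends only on the letter and the set of prefix values, and that set
    is what the downward induction carries along.\<close>
  have count: "inv_count \<rho> i = card {z \<in> \<rho> ` {1..i}. \<rho> i < z}" if "\<rho> permutes {1..n}" for \<rho> i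
  proof -
    have "{z \<in> \<rho> ` {1..i}. \<rho> i < z} = \<rho> ` {j. 1 \<le> j \<and> j < i \<and> \<rho> i < \<rho> j}"
      by (auto simp: image_iff nat_less_le)
    moreover have "inj_on \<rho> {j. 1 \<le> j \<and> j < i \<and> \<rho> i < \<rho> j}"
      using permutes_inj[OF that] by (rule inj_on_subset) simp
    ultimately show ?thesis by (simp add: inv_count_def card_image)
  qed
  have "i \<le> n \<Longrightarrow> \<sigma> ` {1..i} = \<tau> ` {1..i} \<and> (\<forall>j. i < j \<longrightarrow> \<sigma> j = \<tau> j)" for i
  proof (induction i rule: inc_induct)
    case base
    show ?case using permutes_image[OF s] permutes_image[OF t] permutes_not_in[OF s] permutes_not_in[OF t] by simp
  next
    case (step i)
    have im: "\<sigma> ` {1..Suc i} = \<tau> ` {1..Suc i}" using step by blast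
    have e: "\<sigma> (Suc i) = \<tau> (Suc i)"
    proof (rule card_greater_inj[of "\<sigma> ` {1..Suc i}"])
      show "card {z \<in> \<sigma> ` {1..Suc i}. \<sigma> (Suc i) < z} = card {z \<in> \<sigma> ` {1..Suc i}. \<tau> (Suc i) < z}"
        using count[OF s, of "Suc i"] count[OF t, of "Suc i"] cnt[of "Suc i"] step(2) im by simp
      show "\<tau> (Suc i) \<in> \<sigma> ` {1..Suc i}" unfolding im by simp
    qed auto
    have "{1..i} = {1..Suc i} - {Suc i}" by auto
    then have "\<rho> ` {1..i} = \<rho> ` {1..Suc i} - {\<rho> (Suc i)}" if "\<rho> permutes {1..n}" for \<rho>
      using permutes_inj[OF that] by (simp add: image_set_diff)
    then have "\<sigma> ` {1..i} = \<tau> ` {1..i}" using s t im e by metis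
    moreover have "\<forall>j. i < j \<longrightarrow> \<sigma> j = \<tau> j" using step e by (metis Suc_lessI)
    ultimately show ?case by blast
  qed
  from this[of 0] have "\<sigma> j = \<tau> j" if "0 < j" for j using that by blast
  moreover have "\<sigma> 0 = \<tau> 0" using permutes_not_in[OF s, of 0] permutes_not_in[OF t, of 0] by simp
  ultimately show "\<sigma> = \<tau>" by (metis ext gr0I)
qed

text \<open>Injectivity suffices, since both sides have \<open>fact n\<close> elements.\<close>

lemma bij_betw_inv_seq: "bij_betw (inv_seq n) {\<sigma>. \<sigma> permutes {1..n}} (inv_seqs n)"
  unfolding bij_betw_def
proof
  show "inv_seq n ` {\<sigma>. \<sigma> permutes {1..n}} = inv_seqs n"
  proof (rule card_subset_eq[OF finite_inv_seqs])
    show "card (inv_seq n ` {\<sigma>. \<sigma> permutes {1..n}}) = card (inv_seqs n)"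
      unfolding card_image[OF inj_on_inv_seq] card_inv_seqs by (rule card_permutations) simp_all
  qed (auto simp: inv_seq_in_inv_seqs)
qed (rule inj_on_inv_seq)

lemma bij_betw_inv_seq_perms_inv:
  "bij_betw (inv_seq n) (perms_inv n m) (inv_seqs_sum n (int m))"
proof -
  have "bij_betw (inv_seq n) {\<sigma> \<in> {\<sigma>. \<sigma> permutes {1..n}}. card (inversions n \<sigma>) = m}
      {xs \<in> inv_seqs n. int (sum_list xs) = int m}"
    using bij_betw_inv_seq by (rule bij_betw_Collect) (simp add: sum_list_inv_seq)
  then show ?thesis by (simp add: perms_inv_def inv_seqs_sum_def)
qed

text \<open>The entries from position \<open>c\<close> on form an inversion sequence of their own.\<close>

definition cuts :: "nat list \<Rightarrow> nat set" where
  "cuts xs = {c. c \<le> length xs \<and> (\<forall>i<length xs. c \<le> i \<longrightarrow> xs ! i \<le> i - c)}"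

lemma cuts_antimono:
  assumes "list_all2 (\<le>) xs ys"
  shows "cuts ys \<subseteq> cuts xs"
proof
  fix c assume c: "c \<in> cuts ys"
  have len: "length xs = length ys" using assms by (rule list_all2_lengthD)
  have "xs ! i \<le> i - c" if "i < length xs" "c \<le> i" for i
  proof -
    have "ys ! i \<le> i - c" using c that len by (simp add: cuts_def)
    with list_all2_nthD[OF assms that(1)] show ?thesis by simp
  qed
  then show "c \<in> cuts xs" using c len by (simp add: cuts_def)
qed

lemma finite_cuts: "finite (cuts xs)"
  by (rule finite_subset[of _ "{..length xs}"]) (auto simp: cuts_def)

text \<open>If the first \<open>c\<close> letters are the values up to \<open>c\<close>, a later
  letter can be inverted only with positions after \<open>c\<close>. Conversely, small counts force
  every later letter above \<open>c\<close>; the tail then maps into \<open>{c+1..n}\<close>, hence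
  onto it by finiteness.\<close>

lemma image_Icc_iff_inv_count:
  assumes s: "\<sigma> permutes {1..n}" and c: "c \<le> n"
  shows "\<sigma> ` {1..c} = {1..c} \<longleftrightarrow> (\<forall>i<n. c \<le> i \<longrightarrow> inv_count \<sigma> (Suc i) \<le> i - c)"
proof
  assume im: "\<sigma> ` {1..c} = {1..c}"
  show "\<forall>i<n. c \<le> i \<longrightarrow> inv_count \<sigma> (Suc i) \<le> i - c"
  proof (intro allI impI)
    fix i assume i: "i < n" "c \<le> i"
    have "\<sigma> (Suc i) \<notin> \<sigma> ` {1..c}"
      using i inj_image_mem_iff[OF permutes_inj[OF s]] by simp
    moreover have "\<sigma> (Suc i) \<in> {1..n}" using i permutes_in_image[OF s] by simp
    ultimately have gt: "c < \<sigma> (Suc i)" using im by auto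
    have low: "\<sigma> j \<le> c" if "1 \<le> j" "j \<le> c" for j
    proof -
      have "\<sigma> j \<in> \<sigma> ` {1..c}" using that by simp
      then show ?thesis unfolding im by simp
    qed
    have "{j. 1 \<le> j \<and> j < Suc i \<and> \<sigma> (Suc i) < \<sigma> j} \<subseteq> {c<..i}"
    proof
      fix j assume "j \<in> {j. 1 \<le> j \<and> j < Suc i \<and> \<sigma> (Suc i) < \<sigma> j}"
      then show "j \<in> {c<..i}" using low[of j] gt by (cases "j \<le> c") simp_all
    qed
    then have "inv_count \<sigma> (Suc i) \<le> card {c<..i}"
      unfolding inv_count_def by (rule card_mono[rotated]) simp
    then show "inv_count \<sigma> (Suc i) \<le> i - c" by simp
  qed
next
  assume le: "\<forall>i<n. c \<le> i \<longrightarrow> inv_count \<sigma> (Suc i) \<le> i - c"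
  have gt: "c < \<sigma> (Suc i)" if i: "i < n" "c \<le> i" for i
  proof -
    \<comment> \<open>At least \<open>c + 1\<close> of the first \<open>i + 1\<close> letters are at
      most the last of them, so that letter exceeds \<open>c\<close>.\<close>
    let ?S = "{j \<in> {1..Suc i}. \<sigma> j \<le> \<sigma> (Suc i)}"
    have "{1..Suc i} = ?S \<union> {j. 1 \<le> j \<and> j < Suc i \<and> \<sigma> (Suc i) < \<sigma> j}"
      by (auto simp: not_le less_Suc_eq_le le_less)
    then have "Suc i = card (?S \<union> {j. 1 \<le> j \<and> j < Suc i \<and> \<sigma> (Suc i) < \<sigma> j})"
      by (metis card_atLeastAtMost diff_Suc_1)
    also have "\<dots> \<le> card ?S + inv_count \<sigma> (Suc i)"
      unfolding inv_count_def by (rule card_Un_le)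
    finally have "Suc c \<le> card ?S" using le[rule_format, OF i] i by linarith
    also have "card ?S \<le> card {1..\<sigma> (Suc i)}"
    proof (rule card_inj_on_le)
      show "inj_on \<sigma> ?S" using permutes_inj[OF s] by (rule inj_on_subset) simp
      show "\<sigma> ` ?S \<subseteq> {1..\<sigma> (Suc i)}"
        using permutes_in_image[OF s] i by fastforce
    qed simp
    finally show ?thesis by simp
  qed
  have "\<sigma> ` {c+1..n} \<subseteq> {c+1..n}"
  proof (rule image_subsetI)
    fix j assume j: "j \<in> {c+1..n}"
    then have "\<sigma> j \<in> {1..n}" using permutes_in_image[OF s] by simp
    then show "\<sigma> j \<in> {c+1..n}" using gt[of "j - 1"] j by (cases j) simp_all
  qed
  then have tail: "\<sigma> ` {c+1..n} = {c+1..n}"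
    by (rule endo_inj_surj[rotated]) (auto intro: inj_on_subset[OF permutes_inj[OF s]])
  have "{1..c} = {1..n} - {c+1..n}" using c by auto
  then show "\<sigma> ` {1..c} = {1..c}"
    using tail permutes_image[OF s] permutes_inj[OF s] by (simp add: image_set_diff)
qed

lemma cuts_inv_seq:
  assumes "\<sigma> permutes {1..n}"
  shows "cuts (inv_seq n \<sigma>) = {c. c \<le> n \<and> \<sigma> ` {1..c} = {1..c}}"
  using image_Icc_iff_inv_count[OF assms] by (auto simp: cuts_def inv_seq_def)

text \<open>Both ends \<open>0\<close> and \<open>n\<close> are cuts, hence the offset of one.\<close>

lemma card_cuts_inv_seq:
  assumes s: "\<sigma> permutes {1..n}"
  shows "card (cuts (inv_seq n \<sigma>)) = Suc (num_blocks n \<sigma>)"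
proof -
  obtain k where k: "block_cuts n \<sigma> (num_blocks n \<sigma>) k"
    using theI'[OF ex1_block_cuts[OF s]] unfolding num_blocks_def by blast
  have "inj_on k {..num_blocks n \<sigma>}"
    using block_cuts_mono(2)[OF k] by (intro linorder_inj_onI) (auto simp: less_imp_neq)
  then have "card (k ` {..num_blocks n \<sigma>}) = Suc (num_blocks n \<sigma>)" by (simp add: card_image)
  then show ?thesis
    using block_cuts_image[OF permutes_inj[OF s] k] cuts_inv_seq[OF s] by simp
qed

text \<open>Indecomposability means that the cuts \<open>0\<close> and \<open>n\<close>, distinct
  for positive \<open>n\<close>, are the only ones. This makes (i) the case \<open>j = 2\<close> of
  (ii).\<close>

lemma indecomposable_iff_num_blocks:
  assumes s: "\<sigma> permutes {1..n}" and n: "n \<ge> 1"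
  shows "indecomposable n \<sigma> \<longleftrightarrow> \<not> num_blocks n \<sigma> \<ge> 2"
proof -
  define C where "C = {c. c \<le> n \<and> \<sigma> ` {1..c} = {1..c}}"
  have fin: "finite C" unfolding C_def by simp
  have card: "card C = Suc (num_blocks n \<sigma>)"
    using card_cuts_inv_seq[OF s] cuts_inv_seq[OF s] by (simp add: C_def)
  have sub: "{0, n} \<subseteq> C" using permutes_image[OF s] by (simp add: C_def)
  have "indecomposable n \<sigma> \<longleftrightarrow> (\<forall>c\<in>C. \<not> (1 \<le> c \<and> c < n))"
    unfolding indecomposable_on_def decomposable_on_def C_def permutes_image[OF s]
    using less_imp_le by blast
  also have "\<dots> \<longleftrightarrow> C \<subseteq> {0, n}"
  proof -
    have "\<not> (1 \<le> c \<and> c < n) \<longleftrightarrow> c \<in> {0, n}" if "c \<in> C" for c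
      using that by (auto simp: C_def)
    then show ?thesis by blast
  qed
  also have "\<dots> \<longleftrightarrow> card C \<le> 2"
  proof
    assume "C \<subseteq> {0, n}"
    then have "card C \<le> card {0, n}" by (rule card_mono[rotated]) simp
    then show "card C \<le> 2" using n by simp
  next
    assume "card C \<le> 2"
    then have "{0, n} = C" using n by (intro card_seteq[OF fin sub]) simp
    then show "C \<subseteq> {0, n}" by simp
  qed
  finally show ?thesis using card by auto
qed

section \<open>Stochastic domination\<close>

lemma perms_inv_nonempty: "m \<le> n choose 2 \<Longrightarrow> perms_inv n m \<noteq> {}"
  using bij_betw_imp_surj_on[OF bij_betw_inv_seq_perms_inv, of n m] inv_seqs_sum_nonempty[of m n] by auto

lemma finite_perms_inv: "finite (perms_inv n m)"
  by (simp add: bij_betw_finite[OF bij_betw_inv_seq_perms_inv] finite_inv_seqs_sum)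

lemma num_blocks_stochastic_mono:
  assumes m: "m + 1 \<le> n choose 2"
  shows "measure_pmf.prob (random_perm n (m + 1)) {\<sigma>. num_blocks n \<sigma> \<ge> j}
    \<le> measure_pmf.prob (random_perm n m) {\<sigma>. num_blocks n \<sigma> \<ge> j}"
proof -
  \<comment> \<open>Negated, because raising entries destroys cuts; \<open>Suc j\<close>, because
    there is one more cut than blocks.\<close>
  define f where "f xs = - (of_bool (Suc j \<le> card (cuts xs)) :: real)" for xs
  have mono: "f xs \<le> f ys" if "list_all2 (\<le>) xs ys" for xs ys
    using card_mono[OF finite_cuts cuts_antimono[OF that]] by (simp add: f_def)
  have card: "card (inv_seqs_sum n (int m')) = card (perms_inv n m')" for m'
    using bij_betw_same_card[OF bij_betw_inv_seq_perms_inv] by simp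
  have sum: "(\<Sum>xs\<in>inv_seqs_sum n (int m'). f xs) = - real (card (perms_inv n m' \<inter> {\<sigma>. num_blocks n \<sigma> \<ge> j}))" for m'
  proof -
    have "(\<Sum>xs\<in>inv_seqs_sum n (int m'). f xs) = (\<Sum>\<sigma>\<in>perms_inv n m'. f (inv_seq n \<sigma>))"
      by (rule sum.reindex_bij_betw[OF bij_betw_inv_seq_perms_inv, symmetric])
    also have "\<dots> = (\<Sum>\<sigma>\<in>perms_inv n m'. - of_bool (num_blocks n \<sigma> \<ge> j))"
      by (rule sum.cong) (simp_all add: f_def perms_inv_def card_cuts_inv_seq)
    finally show ?thesis by (simp add: sum_negf finite_perms_inv)
  qed
  have prob: "measure_pmf.prob (random_perm n m') A = card (perms_inv n m' \<inter> A) / card (perms_inv n m')"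
    if "m' \<le> n choose 2" for m' A
    unfolding random_perm_def
    by (rule measure_pmf_of_set[OF perms_inv_nonempty[OF that] finite_perms_inv])
  have pos: "0 < card (perms_inv n m')" if "m' \<le> n choose 2" for m'
    using perms_inv_nonempty[OF that] finite_perms_inv by (simp add: card_gt_0_iff)
  have "int m + 1 = int (m + 1)" by simp
  with inv_seqs_sum_mean_mono[of f n "int m", OF mono]
  have "real (card (perms_inv n (m + 1) \<inter> {\<sigma>. num_blocks n \<sigma> \<ge> j})) * card (perms_inv n m)
      \<le> real (card (perms_inv n m \<inter> {\<sigma>. num_blocks n \<sigma> \<ge> j})) * card (perms_inv n (m + 1))"
    by (simp only: sum card) simp
  moreover have "m \<le> n choose 2" using m by simp
  ultimately show ?thesis
    unfolding prob[OF m] prob[OF \<open>m \<le> n choose 2\<close>] using pos[of m] pos[OF m]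
    by (simp add: pos_divide_le_eq pos_le_divide_eq)
qed

theorem theorem2p6:
  fixes n m :: nat
  assumes "n \<ge> 2" and "m \<le> (n choose 2) - 1"
  shows "measure_pmf.prob (random_perm n m) {\<sigma>. indecomposable n \<sigma>}
           \<le> measure_pmf.prob (random_perm n (m + 1)) {\<sigma>. indecomposable n \<sigma>}
         \<and> (\<forall>j\<in>{1..n}.
           measure_pmf.prob (random_perm n (m + 1)) {\<sigma>. num_blocks n \<sigma> \<ge> j}
             \<le> measure_pmf.prob (random_perm n m) {\<sigma>. num_blocks n \<sigma> \<ge> j})"
proof -
  \<comment> \<open>Rules out truncation in the natural-number bound on \<open>m\<close>.\<close>
  have "0 < n choose 2" using assms(1) by simp
  then have m: "m + 1 \<le> n choose 2" using assms(2) by linarith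
  have indec: "measure_pmf.prob (random_perm n m') {\<sigma>. indecomposable n \<sigma>}
      = 1 - measure_pmf.prob (random_perm n m') {\<sigma>. num_blocks n \<sigma> \<ge> 2}" if "m' \<le> n choose 2" for m'
  proof -
    have supp: "set_pmf (random_perm n m') = perms_inv n m'"
      unfolding random_perm_def
      by (rule set_pmf_of_set[OF perms_inv_nonempty[OF that] finite_perms_inv])
    have "measure_pmf.prob (random_perm n m') {\<sigma>. indecomposable n \<sigma>}
        = measure_pmf.prob (random_perm n m') (UNIV - {\<sigma>. num_blocks n \<sigma> \<ge> 2})"
    \<comment> \<open>The two events are compared only on the support, whose elements are
      permutations.\<close>
    proof (rule measure_pmf.finite_measure_eq_AE)
      show "AE \<sigma> in random_perm n m'. (\<sigma> \<in> {\<sigma>. indecomposable n \<sigma>})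
          = (\<sigma> \<in> UNIV - {\<sigma>. num_blocks n \<sigma> \<ge> 2})"
        unfolding AE_measure_pmf_iff supp
      proof
        fix \<sigma> assume "\<sigma> \<in> perms_inv n m'"
        then have "\<sigma> permutes {1..n}" by (simp add: perms_inv_def)
        then show "(\<sigma> \<in> {\<sigma>. indecomposable n \<sigma>}) = (\<sigma> \<in> UNIV - {\<sigma>. num_blocks n \<sigma> \<ge> 2})"
          using indecomposable_iff_num_blocks[of \<sigma> n] assms(1) by simp
      qed
    qed simp_all
    then show ?thesis using measure_pmf.prob_compl[of "{\<sigma>. num_blocks n \<sigma> \<ge> 2}" "random_perm n m'"] by simp
  qed
  show ?thesis
    using num_blocks_stochastic_mono[OF m] indec m by simp
qed

end
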